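(* The total expected revenue function $TER$ is $\left(\sum_{j=1}^{J}\frac{\mathcal{N}_j}{\beta_j}+\sum_{k=1}^{K}\frac{1}{\Gamma_k}\right)$-strongly smooth with respect to $\|\cdot\|_2$, where $\beta_j=\min_{1\le\ell\le L_j}\mu_{j\ell}$; that is, for all price vectors $p,\bar p$, $$\|\nabla TER(p)-\nabla TER(\bar p)\|_2\le\left(\sum_{j=1}^{J}\frac{\mathcal{N}_j}{\beta_j}+\sum_{k=1}^{K}\frac{1}{\Gamma_k}\right)\|p-\bar p\|_2 .$$
   Context: $\langle\cdot,\cdot\rangle$ is the standard inner product on $\mathbb{R}^n$. Price vectors are elements of $\mathbb{R}^n_+$ (the nonnegative orthant); the formulas below make sense for all $p\in\mathbb{R}^n$, and $TER$ is differentiable. Demand. There are $n$ products and $J$ types of consumers, with $\mathcal{N}_j>0$ consumers of type $j$. For type $j$ there is a vector of observable utilities $a_j\in\mathbb{R}^n$, a partition of $\{1,\dots,n\}$ into nonempty nests $N_{j1},\dots,N_{jL_j}$, and nest parameters $0<\mu_{j\ell}\le 1$. The expected revenue (nested logit surplus) of a type-$j$ consumer at prices $p$ is $$E_j(p)=\ln\left(\sum_{\ell=1}^{L_j}\Big(\sum_{i\in N_{j\ell}}e^{(a_j^{(i)}-p^{(i)})/\mu_{j\ell}}\Big)^{\mu_{j\ell}}\right).$$ Supply. There are $K$ suppliers. Supplier $k$ has a nonempty closed convex set $\mathcal{Y}_k\subset\mathbb{R}^n$ and cost function $c_k(y)=\hat c_k(y)+\Gamma_k\|y-\hat y_k\|_2^2$,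 where $\hat c_k:\mathbb{R}^n\to\mathbb{R}$ is convex, $\Gamma_k>0$ and $\hat y_k\in\mathbb{R}^n$. Its profit is $\pi_k(p)=\max_{y\in\mathcal{Y}_k}\langle p,y\rangle-c_k(y)$. The total expected revenue function is $TER(p)=\sum_{k=1}^K\pi_k(p)+\sum_{j=1}^J\mathcal{N}_jE_j(p)$. *)

theory Defs
  imports "HOL-Analysis.Analysis"
begin

text \<open>Products are the elements of the finite index type \<open>'n\<close>, so that the space of prices and of
  quantities is \<open>real^'n\<close>, whose \<open>norm\<close> is the Euclidean norm.\<close>

definition price_vectors :: "(real^'n) set" where
  "price_vectors = {p. \<forall>i. 0 \<le> p $ i}"

definition nested_logit_surplus ::
    "real^'n \<Rightarrow> nat \<Rightarrow> (nat \<Rightarrow> 'n set) \<Rightarrow> (nat \<Rightarrow> real) \<Rightarrow> real^'n \<Rightarrow> real" where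
  "nested_logit_surplus a L N \<mu> p =
     ln (\<Sum>l\<in>{1..L}. (\<Sum>i\<in>N l. exp ((a $ i - p $ i) / \<mu> l)) powr \<mu> l)"

definition cost :: "(real^'n \<Rightarrow> real) \<Rightarrow> real \<Rightarrow> real^'n \<Rightarrow> real^'n \<Rightarrow> real" where
  "cost chat \<Gamma> yhat y = chat y + \<Gamma> * (norm (y - yhat))\<^sup>2"

text \<open>A maximum, not a supremum: the value is meaningful only if it is attained on \<open>Y\<close>.\<close>

definition profit :: "(real^'n) set \<Rightarrow> (real^'n \<Rightarrow> real) \<Rightarrow> real^'n \<Rightarrow> real" where
  "profit Y c p = (GREATEST v. v \<in> (\<lambda>y. p \<bullet> y - c y) ` Y)"

definition TER ::
    "nat \<Rightarrow> (nat \<Rightarrow> real^'n \<Rightarrow> real) \<Rightarrow> nat \<Rightarrow> (nat \<Rightarrow> real) \<Rightarrow> (nat \<Rightarrow> real^'n \<Rightarrow> real)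
      \<Rightarrow> real^'n \<Rightarrow> real" where
  "TER K \<pi> J \<N> E p = (\<Sum>k\<in>{1..K}. \<pi> k p) + (\<Sum>j\<in>{1..J}. \<N> j * E j p)"

definition gradient :: "('a::real_inner \<Rightarrow> real) \<Rightarrow> 'a \<Rightarrow> 'a" where
  "gradient f x = (THE D. GDERIV f x :> D)"

text \<open>Differentiability is with respect to the whole space, also at boundary points of \<open>S\<close>. It is
  required explicitly because \<open>gradient\<close> is arbitrary where \<open>f\<close> is not differentiable.\<close>

definition strongly_smooth_on :: "'a::euclidean_space set \<Rightarrow> real \<Rightarrow> ('a \<Rightarrow> real) \<Rightarrow> bool" where
  "strongly_smooth_on S \<beta> f \<longleftrightarrow>
     (\<forall>x\<in>S. f differentiable (at x)) \<and>
     (\<forall>x\<in>S. \<forall>y\<in>S. norm (gradient f x - gradient f y) \<le> \<beta> * norm (x - y))"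

end

theory Submission
  imports Defs "HOL-Probability.Hoeffding"
begin

text \<open>A function trapped between affine minorants and the same affine functions plus
  \<open>L / 2 * (norm d)\<^sup>2\<close> has an \<open>L\<close>-Lipschitz gradient, and such bounds add up, so each
  supplier and each consumer type can be treated separately. For a supplier the gradient is the
  profit-maximizing quantity, and strong convexity of the cost gives \<open>L = 1 / \<Gamma>\<close>. For a consumer
  no second derivatives are needed: a price change \<open>d\<close> turns the surplus into a two-stage
  log-moment generating function of \<open>- d\<close>. Jensen's inequality bounds it from below, and
  Hoeffding's lemma from above with error \<open>r\<^sup>2 / (8 * \<beta>)\<close> within the nests and \<open>r\<^sup>2 / 8\<close> between
  them, where the range \<open>r\<close> of \<open>d\<close> satisfies \<open>r\<^sup>2 \<le> 2 * (norm d)\<^sup>2\<close>. Since \<open>\<beta> \<le> 1\<close>,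
  the total is at most \<open>(norm d)\<^sup>2 / (2 * \<beta>)\<close>.\<close>

section \<open>Quadratic bounds and Lipschitz gradients\<close>

text \<open>The lower inequality is convexity with subgradient \<open>g x\<close>, the upper one the
  descent inequality. Differentiability is not presupposed; it follows from the two.\<close>

definition quadratic_bounds ::
    "('a::real_inner \<Rightarrow> real) \<Rightarrow> ('a \<Rightarrow> 'a) \<Rightarrow> real \<Rightarrow> bool" where
  "quadratic_bounds f g L \<longleftrightarrow>
     (\<forall>x d. f x + g x \<bullet> d \<le> f (x + d) \<and> f (x + d) \<le> f x + g x \<bullet> d + L / 2 * (norm d)\<^sup>2)"

lemma quadratic_boundsD:
  assumes "quadratic_bounds f g L"
  shows "f x + g x \<bullet> d \<le> f (x + d)" "f (x + d) \<le> f x + g x \<bullet> d + L / 2 * (norm d)\<^sup>2"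
  using assms unfolding quadratic_bounds_def by auto

lemma quadratic_bounds_mono:
  assumes "quadratic_bounds f g L" "L \<le> L'"
  shows "quadratic_bounds f g L'"
  unfolding quadratic_bounds_def
proof (intro allI conjI)
  fix x d
  show "f x + g x \<bullet> d \<le> f (x + d)"
    by (rule quadratic_boundsD[OF assms(1)])
  have "L / 2 * (norm d)\<^sup>2 \<le> L' / 2 * (norm d)\<^sup>2"
    using assms(2) by (intro mult_right_mono) auto
  with quadratic_boundsD(2)[OF assms(1), of x d]
  show "f (x + d) \<le> f x + g x \<bullet> d + L' / 2 * (norm d)\<^sup>2"
    by linarith
qed

lemma quadratic_bounds_add:
  assumes "quadratic_bounds f g L" "quadratic_bounds f' g' L'"
  shows "quadratic_bounds (\<lambda>x. f x + f' x) (\<lambda>x. g x + g' x) (L + L')"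
  unfolding quadratic_bounds_def
proof (intro allI)
  fix x d
  show "f x + f' x + (g x + g' x) \<bullet> d \<le> f (x + d) + f' (x + d) \<and>
        f (x + d) + f' (x + d) \<le> f x + f' x + (g x + g' x) \<bullet> d + (L + L') / 2 * (norm d)\<^sup>2"
    using quadratic_boundsD[OF assms(1), of x d] quadratic_boundsD[OF assms(2), of x d]
    by (auto simp: inner_add_left add_divide_distrib distrib_right)
qed

lemma quadratic_bounds_cmult:
  assumes "quadratic_bounds f g L" "0 \<le> c"
  shows "quadratic_bounds (\<lambda>x. c * f x) (\<lambda>x. c *\<^sub>R g x) (c * L)"
  unfolding quadratic_bounds_def
proof (intro allI)
  fix x d
  show "c * f x + c *\<^sub>R g x \<bullet> d \<le> c * f (x + d) \<and>
        c * f (x + d) \<le> c * f x + c *\<^sub>R g x \<bullet> d + c * L / 2 * (norm d)\<^sup>2"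
    using mult_left_mono[OF quadratic_boundsD(1)[OF assms(1), of x d] assms(2)]
      mult_left_mono[OF quadratic_boundsD(2)[OF assms(1), of x d] assms(2)]
    by (simp add: algebra_simps)
qed

lemma quadratic_bounds_sum:
  assumes "finite I" "\<And>i. i \<in> I \<Longrightarrow> quadratic_bounds (f i) (g i) (L i)"
  shows "quadratic_bounds (\<lambda>x. \<Sum>i\<in>I. f i x) (\<lambda>x. \<Sum>i\<in>I. g i x) (\<Sum>i\<in>I. L i)"
  using assms
proof (induction rule: finite_induct)
  case empty
  then show ?case by (simp add: quadratic_bounds_def)
next
  case (insert i I)
  then show ?case by (simp add: quadratic_bounds_add)
qed

text \<open>The first-order remainder is squeezed between \<open>0\<close> and a multiple of
  \<open>(norm d)\<^sup>2\<close>, so it vanishes faster than \<open>norm d\<close>.\<close>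

lemma quadratic_bounds_GDERIV:
  assumes "quadratic_bounds f g L"
  shows "GDERIV f x :> g x"
  unfolding gderiv_def has_derivative_at
proof (intro conjI)
  show "bounded_linear (\<lambda>h. h \<bullet> g x)"
    by (rule bounded_linear_inner_left)
  have lim: "((\<lambda>d::'a. \<bar>L / 2\<bar> * norm d) \<longlongrightarrow> 0) (at 0)"
    by (intro tendsto_mult_right_zero tendsto_norm_zero tendsto_ident_at)
  show "(\<lambda>d. norm (f (x + d) - f x - d \<bullet> g x) / norm d) \<midarrow>0\<rightarrow> 0"
  proof (rule Lim_null_comparison[OF _ lim], rule always_eventually, rule allI)
    fix d :: 'a
    have "\<bar>f (x + d) - f x - d \<bullet> g x\<bar> \<le> L / 2 * (norm d)\<^sup>2"
      using quadratic_boundsD[OF assms, of x d] by (auto simp: inner_commute abs_le_iff)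
    also have "\<dots> \<le> \<bar>L / 2\<bar> * (norm d)\<^sup>2"
      by (intro mult_right_mono) auto
    finally show "norm (norm (f (x + d) - f x - d \<bullet> g x) / norm d) \<le> \<bar>L / 2\<bar> * norm d"
      by (cases "d = 0") (auto simp: field_simps power2_eq_square)
  qed
qed

text \<open>Tilting \<open>f\<close> by \<open>g x\<close> makes \<open>x\<close> a minimizer; comparing its value with
  the value after a gradient step of length \<open>1 / L\<close> from \<open>y\<close> gives
  co-coercivity of \<open>g\<close>.\<close>

lemma quadratic_bounds_cocoercive:
  assumes "quadratic_bounds f g L" "0 < L"
  shows "(norm (g x - g y))\<^sup>2 / L \<le> (g x - g y) \<bullet> (x - y)"
proof -
  have *: "f x - f y - g x \<bullet> (x - y) \<le> - (norm (g y - g x))\<^sup>2 / (2 * L)" for x y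
  proof -
    define v where "v = g y - g x"
    define s where "s = - (1 / L) *\<^sub>R v"
    have "f x + g x \<bullet> (y + s - x) \<le> f (y + s)"
      using quadratic_boundsD(1)[OF assms(1), of x "y + s - x"] by simp
    also have "\<dots> \<le> f y + g y \<bullet> s + L / 2 * (norm s)\<^sup>2"
      by (rule quadratic_boundsD[OF assms(1)])
    finally have "f x - f y - g x \<bullet> (x - y) \<le> v \<bullet> s + L / 2 * (norm s)\<^sup>2"
      by (simp add: v_def inner_diff_left inner_diff_right inner_add_right)
    also have "v \<bullet> s = - (norm v)\<^sup>2 / L"
      by (simp add: s_def power2_norm_eq_inner)
    also have "(norm s)\<^sup>2 = (norm v)\<^sup>2 / L\<^sup>2"
      by (simp add: s_def power_mult_distrib power_divide)
    finally show ?thesis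
      using assms(2) by (simp add: v_def field_simps power2_eq_square)
  qed
  \<comment> \<open>Adding the two instances cancels the function values.\<close>
  have "(g y - g x) \<bullet> (x - y) \<le> - (norm (g x - g y))\<^sup>2 / (2 * L) - (norm (g x - g y))\<^sup>2 / (2 * L)"
    using *[of x y] *[of y x]
    by (simp add: norm_minus_commute inner_diff_left inner_diff_right)
  then show ?thesis
    by (simp add: inner_diff_left)
qed

text \<open>Cauchy-Schwarz and cancelling one norm turn co-coercivity into the Lipschitz bound.
  Co-coercivity divides by the modulus, so it is used for every \<open>L' > L\<close>; letting
  \<open>L'\<close> tend to \<open>L\<close> also covers \<open>L = 0\<close>.\<close>

lemma quadratic_bounds_Lipschitz:
  assumes "quadratic_bounds f g L" "0 \<le> L"
  shows "norm (g x - g y) \<le> L * norm (x - y)"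
proof -
  have *: "norm (g x - g y) \<le> L' * norm (x - y)" if "L < L'" for L'
  proof -
    have L': "0 < L'" using that assms(2) by simp
    have "quadratic_bounds f g L'"
      using assms(1) that by (auto intro: quadratic_bounds_mono)
    from quadratic_bounds_cocoercive[OF this L']
    have "(norm (g x - g y))\<^sup>2 \<le> L' * ((g x - g y) \<bullet> (x - y))"
      using L' by (simp add: field_simps)
    also have "\<dots> \<le> L' * (norm (g x - g y) * norm (x - y))"
      using L' by (intro mult_left_mono norm_cauchy_schwarz) auto
    finally have "norm (g x - g y) * norm (g x - g y) \<le> norm (g x - g y) * (L' * norm (x - y))"
      by (simp add: power2_eq_square mult_ac)
    then show ?thesis
      using L' by (cases "g x = g y") auto
  qed
  show ?thesis
  proof (rule field_le_epsilon)
    fix e :: real assume e: "0 < e"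
    \<comment> \<open>The excess over \<open>L\<close> will be
      \<open>e / (norm (x - y) + 1)\<close>; the \<open>1\<close> keeps the denominator positive
      when \<open>x = y\<close>.\<close>
    have pos: "0 < norm (x - y) + 1"
      by (rule add_nonneg_pos) auto
    have "norm (g x - g y) \<le> (L + e / (norm (x - y) + 1)) * norm (x - y)"
      using e pos by (intro *) simp
    also have "\<dots> = L * norm (x - y) + e * (norm (x - y) / (norm (x - y) + 1))"
      by (simp add: algebra_simps)
    also have "\<dots> \<le> L * norm (x - y) + e"
      using e pos by (intro add_left_mono mult_left_le) (auto simp: field_simps)
    finally show "norm (g x - g y) \<le> L * norm (x - y) + e" .
  qed
qed

text \<open>Two candidates represent the same linear functional; evaluating it at their difference
  shows that the difference is zero.\<close>

lemma GDERIV_gradient: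
  assumes "GDERIV f x :> D"
  shows "gradient f x = D"
  unfolding gradient_def
proof (rule the_equality)
  show "GDERIV f x :> D" by fact
next
  fix D' assume "GDERIV f x :> D'"
  with assms have "(\<lambda>h. h \<bullet> D') = (\<lambda>h. h \<bullet> D)"
    unfolding gderiv_def by (rule has_derivative_unique[rotated])
  then have "(D' - D) \<bullet> D' = (D' - D) \<bullet> D"
    by metis
  then have "(D' - D) \<bullet> (D' - D) = 0"
    by (simp add: inner_diff_right)
  then show "D' = D" by simp
qed

lemma quadratic_bounds_strongly_smooth:
  assumes "quadratic_bounds f g L" "0 \<le> L"
  shows "strongly_smooth_on S L f"
proof -
  have "f differentiable (at x)" for x
    using quadratic_bounds_GDERIV[OF assms(1), of x]
    unfolding gderiv_def differentiable_def by blast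
  moreover have "gradient f x = g x" for x
    by (rule GDERIV_gradient[OF quadratic_bounds_GDERIV[OF assms(1)]])
  ultimately show ?thesis
    unfolding strongly_smooth_on_def
    using quadratic_bounds_Lipschitz[OF assms] by simp
qed

section \<open>Profits\<close>

text \<open>The segment from \<open>z\<close> to a far point \<open>y\<close> crosses the unit
  sphere around \<open>z\<close>, where \<open>f\<close> is at least its minimum \<open>m\<close> on
  the ball. Convexity along the segment then lets \<open>f\<close> fall at most linearly.\<close>

lemma convex_on_linear_lower_bound:
  fixes f :: "'a::euclidean_space \<Rightarrow> real"
  assumes "convex_on UNIV f"
  obtains A B where "\<And>y. norm (y - z) \<ge> 1 \<Longrightarrow> A - B * norm (y - z) \<le> f y"
proof -
  have cont: "continuous_on UNIV f"
    using assms by (intro convex_on_continuous) auto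
  have "\<exists>x\<in>cball z 1. \<forall>y\<in>cball z 1. f x \<le> f y"
    by (intro continuous_attains_inf continuous_on_subset[OF cont]) auto
  then obtain m where m: "\<And>y. y \<in> cball z 1 \<Longrightarrow> m \<le> f y"
    by blast
  show thesis
  proof (rule that)
    fix y assume r: "norm (y - z) \<ge> 1"
    define r where "r = norm (y - z)"
    have r1: "r \<ge> 1" using r by (simp add: r_def)
    define w where "w = (1 - 1 / r) *\<^sub>R z + (1 / r) *\<^sub>R y"
    have "w - z = (1 / r) *\<^sub>R (y - z)"
      by (simp add: w_def algebra_simps)
    then have "norm (w - z) = 1"
      using r1 by (auto simp: r_def)
    then have "w \<in> cball z 1"
      by (simp add: dist_norm norm_minus_commute)
    then have "m \<le> f w" by (rule m)
    also have "f w \<le> (1 - 1 / r) * f z + (1 / r) * f y"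
      unfolding w_def using r1 by (intro convex_onD[OF assms]) auto
    finally have "r * m \<le> r * ((1 - 1 / r) * f z + (1 / r) * f y)"
      using r1 by (intro mult_left_mono) auto
    also have "\<dots> = (r - 1) * f z + f y"
      using r1 by (simp add: field_simps)
    finally show "f z - (f z - m) * norm (y - z) \<le> f y"
      unfolding r_def by (simp add: algebra_simps)
  qed
qed

text \<open>Attainment gives the \<open>GREATEST\<close> in \<open>profit\<close> its meaning. The
  quadratic cost term beats the linear decrease of \<open>chat\<close>, so far points do no better
  than a fixed feasible \<open>y0\<close>, and compactness settles the rest.\<close>

lemma profit_maximizer_exists:
  fixes Y :: "(real^'n) set"
  assumes "Y \<noteq> {}" "closed Y" "convex_on UNIV chat" "0 < \<Gamma>"
  shows "\<exists>y\<in>Y. \<forall>z\<in>Y. p \<bullet> z - cost chat \<Gamma> yhat z \<le> p \<bullet> y - cost chat \<Gamma> yhat y"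
proof -
  define h where "h = (\<lambda>y. p \<bullet> y - cost chat \<Gamma> yhat y)"
  obtain y0 where y0: "y0 \<in> Y" using assms(1) by blast
  obtain A B where AB: "\<And>y. norm (y - yhat) \<ge> 1 \<Longrightarrow> A - B * norm (y - yhat) \<le> chat y"
    using convex_on_linear_lower_bound[OF assms(3)] by metis
  \<comment> \<open>For \<open>r = norm (y - yhat)\<close> with \<open>r \<ge> 1\<close>, the gain
    of \<open>y\<close> over \<open>y0\<close> is at most \<open>(C - \<Gamma> * r) * r\<close>. The
    three entries of \<open>R\<close> make the linear bound applicable, this gain nonpositive, and
    \<open>y0\<close> a point of the ball.\<close>
  define C where "C = \<bar>p \<bullet> yhat - A - h y0\<bar> + \<bar>norm p + B\<bar>"
  define R where "R = Max {1, C / \<Gamma>, norm (y0 - yhat)}"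
  have R: "1 \<le> R" "C / \<Gamma> \<le> R" "norm (y0 - yhat) \<le> R"
    unfolding R_def by simp_all
  have far: "h y \<le> h y0" if "norm (y - yhat) > R" for y
  proof -
    define r where "r = norm (y - yhat)"
    have r: "1 \<le> r" "C / \<Gamma> \<le> r"
      using that R unfolding r_def by auto
    from r(2) have C: "C \<le> \<Gamma> * r"
      using assms(4) by (simp add: field_simps)
    have "p \<bullet> y = p \<bullet> yhat + p \<bullet> (y - yhat)"
      by (simp add: inner_diff_right)
    also have "\<dots> \<le> p \<bullet> yhat + norm p * r"
      unfolding r_def by (intro add_left_mono norm_cauchy_schwarz)
    finally have "h y \<le> p \<bullet> yhat + norm p * r - (A - B * r) - \<Gamma> * r\<^sup>2"
      using AB[of y] r(1) unfolding h_def cost_def r_def by linarith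
    then have "h y - h y0 \<le> \<bar>p \<bullet> yhat - A - h y0\<bar> * 1 + (norm p + B) * r - \<Gamma> * r\<^sup>2"
      by (simp add: algebra_simps)
    also have "\<dots> \<le> \<bar>p \<bullet> yhat - A - h y0\<bar> * r + \<bar>norm p + B\<bar> * r - \<Gamma> * r\<^sup>2"
      using r(1) assms(4) by (intro add_mono diff_mono mult_mono) auto
    also have "\<dots> = (C - \<Gamma> * r) * r"
      by (simp add: C_def algebra_simps power2_eq_square)
    also have "\<dots> \<le> 0"
      using r(1) C by (simp add: mult_nonpos_nonneg)
    finally show ?thesis by simp
  qed
  have "continuous_on UNIV chat"
    using assms(3) by (intro convex_on_continuous) auto
  then have cont: "continuous_on UNIV h"
    unfolding h_def cost_def by (intro continuous_intros)
  have "y0 \<in> Y \<inter> cball yhat R"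
    using y0 R(3) by (simp add: dist_norm norm_minus_commute)
  moreover have "compact (Y \<inter> cball yhat R)"
    using assms(2) by (intro closed_Int_compact) auto
  ultimately obtain y where y: "y \<in> Y \<inter> cball yhat R" "\<And>z. z \<in> Y \<inter> cball yhat R \<Longrightarrow> h z \<le> h y"
    using continuous_attains_sup[of "Y \<inter> cball yhat R" h] continuous_on_subset[OF cont] by blast
  have "h z \<le> h y" if "z \<in> Y" for z
  proof (cases "norm (z - yhat) \<le> R")
    case True
    then show ?thesis using that y(2)[of z] by (simp add: dist_norm norm_minus_commute)
  next
    case False
    then have "h z \<le> h y0" by (intro far) simp
    also have "h y0 \<le> h y" by (rule y(2)) fact
    finally show ?thesis .
  qed
  then show ?thesis using y(1) unfolding h_def by blast
qed

text \<open>The profit is a maximum of functions affine in \<open>p\<close> with slope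
  \<open>y\<close>, so a maximizer is a subgradient. Quadratic decay of the objective away from the
  maximizer limits how far it can move, which gives the upper bound.\<close>

lemma profit_quadratic_bounds:
  fixes Y :: "(real^'n) set"
  assumes "Y \<noteq> {}" "closed Y" "convex Y" "convex_on UNIV chat" "0 < \<Gamma>"
  shows "\<exists>g. quadratic_bounds (profit Y (cost chat \<Gamma> yhat)) g (1 / \<Gamma>)"
proof -
  define h where "h = (\<lambda>p y. p \<bullet> y - cost chat \<Gamma> yhat y)"
  have "\<forall>p. \<exists>y. y \<in> Y \<and> (\<forall>z\<in>Y. h p z \<le> h p y)"
    using profit_maximizer_exists[OF assms(1,2,4,5)] unfolding h_def by blast
  then obtain g where g: "\<And>p. g p \<in> Y" "\<And>p z. z \<in> Y \<Longrightarrow> h p z \<le> h p (g p)"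
    by metis
  have profit: "profit Y (cost chat \<Gamma> yhat) p = h p (g p)" for p
    unfolding profit_def using g(1)[of p] g(2)[of _ p]
    by (intro Greatest_equality) (auto simp: h_def)
  txt \<open>Strong concavity is only used at the midpoint, which costs a factor 2 in the modulus;
    \<open>1 / \<Gamma>\<close> leaves room for that.\<close>
  have strong: "h p y \<le> h p (g p) - \<Gamma> / 2 * (norm (y - g p))\<^sup>2" if "y \<in> Y" for p y
  proof -
    define m where "m = (1 - 1 / 2) *\<^sub>R g p + (1 / 2) *\<^sub>R y"
    have "m \<in> Y"
      unfolding m_def using assms(3) g(1)[of p] that by (intro convexD) auto
    have chat: "chat m \<le> (1 - 1 / 2) * chat (g p) + (1 / 2) * chat y"
      unfolding m_def by (intro convex_onD[OF assms(4)]) auto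
    \<comment> \<open>The parallelogram law.\<close>
    have "(norm (m - yhat))\<^sup>2 = (norm (g p - yhat))\<^sup>2 / 2 + (norm (y - yhat))\<^sup>2 / 2
        - (norm (y - g p))\<^sup>2 / 4"
      unfolding power2_norm_eq_inner m_def
      by (simp add: inner_add_left inner_add_right inner_diff_left inner_diff_right
          inner_commute field_simps)
    then have sq: "\<Gamma> * (norm (m - yhat))\<^sup>2 = \<Gamma> * (norm (g p - yhat))\<^sup>2 / 2
        + \<Gamma> * (norm (y - yhat))\<^sup>2 / 2 - \<Gamma> * (norm (y - g p))\<^sup>2 / 4"
      by (simp only: right_diff_distrib distrib_left times_divide_eq_right)
    have lin: "p \<bullet> m = p \<bullet> g p / 2 + p \<bullet> y / 2"
      by (simp add: m_def inner_add_right)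
    have "h p m \<le> h p (g p)"
      by (rule g) fact
    with chat sq lin show ?thesis
      unfolding h_def cost_def by simp
  qed
  have "quadratic_bounds (profit Y (cost chat \<Gamma> yhat)) g (1 / \<Gamma>)"
    unfolding quadratic_bounds_def profit
  proof (intro allI conjI)
    fix p d
    have shift: "h (p + d) y = h p y + d \<bullet> y" for y
      by (simp add: h_def inner_add_left)
    show "h p (g p) + g p \<bullet> d \<le> h (p + d) (g (p + d))"
      using g(2)[OF g(1), of "p + d" p] by (simp add: shift inner_commute)
    define w where "w = g (p + d) - g p"
    \<comment> \<open>This square yields Young's inequality for \<open>d \<bullet> w\<close>,
      weighted so that its \<open>w\<close> term is exactly the loss in
      \<open>strong\<close>.\<close>
    have "0 \<le> (norm (\<Gamma> *\<^sub>R w - d))\<^sup>2"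
      by simp
    also have "\<dots> = \<Gamma>\<^sup>2 * (norm w)\<^sup>2 - 2 * \<Gamma> * (d \<bullet> w) + (norm d)\<^sup>2"
      unfolding power2_norm_eq_inner
      by (simp add: inner_diff_left inner_diff_right inner_commute power2_eq_square)
    finally have "d \<bullet> w \<le> \<Gamma> / 2 * (norm w)\<^sup>2 + 1 / \<Gamma> / 2 * (norm d)\<^sup>2"
      using assms(5) by (simp add: field_simps power2_eq_square)
    moreover have "h (p + d) (g (p + d)) \<le> h p (g p) - \<Gamma> / 2 * (norm w)\<^sup>2 + d \<bullet> g (p + d)"
      using strong[OF g(1), of p "p + d"] by (simp add: shift w_def)
    moreover have "d \<bullet> g (p + d) = g p \<bullet> d + d \<bullet> w"
      by (simp add: w_def inner_diff_right inner_commute)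
    ultimately show "h (p + d) (g (p + d)) \<le> h p (g p) + g p \<bullet> d + 1 / \<Gamma> / 2 * (norm d)\<^sup>2"
      by linarith
  qed
  then show ?thesis by blast
qed

section \<open>Nested logit surplus\<close>

text \<open>These are bounds on the log-moment generating function of a random variable with law
  \<open>w\<close>: Jensen below, Hoeffding above. The last two keep the value within the range of
  \<open>x\<close>, so that the lemma can be applied a second time to such values.\<close>

lemma ln_sum_exp_bounds:
  fixes w x :: "'i \<Rightarrow> real"
  assumes "finite I" "\<And>i. i \<in> I \<Longrightarrow> 0 \<le> w i" "(\<Sum>i\<in>I. w i) = 1"
    and x: "\<And>i. i \<in> I \<Longrightarrow> l \<le> x i \<and> x i \<le> u"
  shows "0 < (\<Sum>i\<in>I. w i * exp (x i))"
    and "(\<Sum>i\<in>I. w i * x i) \<le> ln (\<Sum>i\<in>I. w i * exp (x i))"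
    and "ln (\<Sum>i\<in>I. w i * exp (x i)) \<le> (\<Sum>i\<in>I. w i * x i) + (u - l)\<^sup>2 / 8"
    and "l \<le> ln (\<Sum>i\<in>I. w i * exp (x i))"
    and "ln (\<Sum>i\<in>I. w i * exp (x i)) \<le> u"
proof -
  define m where "m = (\<Sum>i\<in>I. w i * x i)"
  let ?S = "\<Sum>i\<in>I. w i * exp (x i)"
  have "I \<noteq> {}" using assms(3) by auto
  have jensen: "exp m \<le> ?S"
    using convex_on_sum[OF assms(1) \<open>I \<noteq> {}\<close> exp_convex assms(3), of x] assms(2)
    by (simp add: m_def)
  show pos: "0 < ?S"
    using jensen exp_gt_zero[of m] by linarith
  show low: "m \<le> ln ?S"
    using jensen pos by (simp add: ln_ge_iff)
  have const: "(\<Sum>i\<in>I. w i * c) = c" for c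
    using assms(3) by (simp flip: sum_distrib_right)
  have lm: "l \<le> m"
    unfolding m_def using assms(2) x by (subst const[of l, symmetric], intro sum_mono mult_left_mono) auto
  with low show "l \<le> ln ?S" by simp
  have "?S \<le> exp u"
    using assms(2) x by (subst const[of "exp u", symmetric], intro sum_mono mult_left_mono) auto
  then show "ln ?S \<le> u"
    using pos by (simp add: ln_le_cancel_iff[of ?S "exp u", simplified])
  \<comment> \<open>A degenerate range is split off because the chord argument divides by
    \<open>u - l\<close>.\<close>
  show "ln ?S \<le> m + (u - l)\<^sup>2 / 8"
  proof (cases "u \<le> l")
    case True
    have "ln ?S \<le> u" by fact
    also have "u \<le> m" using True lm by simp
    finally show ?thesis by (simp add: add_increasing2)
  next
    case False
    define h where "h = u - l"
    \<comment> \<open>The mass at \<open>u\<close> of the two-point law on \<open>l\<close> and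
      \<open>u\<close> with mean \<open>m\<close>, which Hoeffding's argument compares with
      \<open>w\<close>.\<close>
    define t where "t = (m - l) / h"
    have h: "0 < h" using False by (simp add: h_def)
    have t: "0 \<le> t" using lm h by (simp add: t_def)
    \<comment> \<open>On \<open>[l, u]\<close> the exponential lies below its chord.\<close>
    have pointwise: "exp (x i) \<le> exp l * (1 + (x i - l) / h * (exp h - 1))" if "i \<in> I" for i
    proof -
      define s where "s = (x i - l) / h"
      have s: "0 \<le> s" "s \<le> 1" using x[OF that] h by (auto simp: s_def h_def)
      have "exp ((1 - s) *\<^sub>R l + s *\<^sub>R u) \<le> (1 - s) * exp l + s * exp u"
        using s by (intro convex_onD[OF exp_convex]) auto
      also have "(1 - s) *\<^sub>R l + s *\<^sub>R u = l + s * h"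
        by (simp add: h_def algebra_simps)
      also have "\<dots> = x i" using h by (simp add: s_def)
      also have "exp u = exp l * exp h" by (simp add: h_def flip: exp_add)
      finally show ?thesis by (simp add: s_def[symmetric] algebra_simps)
    qed
    have "?S \<le> (\<Sum>i\<in>I. w i * (exp l * (1 + (x i - l) / h * (exp h - 1))))"
      using assms(2) pointwise by (intro sum_mono mult_left_mono) auto
    also have "\<dots> = exp l * ((\<Sum>i\<in>I. w i) + ((\<Sum>i\<in>I. w i * x i) - (\<Sum>i\<in>I. w i * l)) / h * (exp h - 1))"
      by (simp add: sum_distrib_left sum_distrib_right sum_divide_distrib
          flip: sum_subtractf sum.distrib) (simp add: algebra_simps diff_divide_distrib)
    also have "\<dots> = exp l * (1 + t * (exp h - 1))"
      by (simp add: assms(3) const t_def m_def)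
    finally have S: "?S \<le> exp l * (1 + t * (exp h - 1))" .
    have pos': "0 < 1 + t * (exp h - 1)"
      using t h by (intro add_pos_nonneg mult_nonneg_nonneg) auto
    have "ln ?S \<le> ln (exp l * (1 + t * (exp h - 1)))"
      using S pos by simp
    also have "\<dots> = l + ln (1 + t * (exp h - 1))"
      using pos' by (simp add: ln_mult)
    also have "\<dots> \<le> l + (h * t + h\<^sup>2 / 8)"
      using Hoeffdings_lemma_aux[of h t] h t by simp
    also have "h * t = m - l" using h by (simp add: t_def)
    finally show ?thesis by (simp add: h_def)
  qed
qed

text \<open>The range is a difference of two coordinates, and
  \<open>(s - t)\<^sup>2 \<le> 2 * (s\<^sup>2 + t\<^sup>2)\<close>. Distinct indices are needed for
  both squares to be separate summands of the squared norm.\<close>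

lemma range_square_le:
  fixes d :: "real^'n"
  obtains l u where "\<And>i. l \<le> d $ i \<and> d $ i \<le> u" "(u - l)\<^sup>2 \<le> 2 * (norm d)\<^sup>2"
proof -
  have "Min (range (($) d)) \<in> range (($) d)" "Max (range (($) d)) \<in> range (($) d)"
    by (auto intro!: Min_in Max_in)
  then obtain i j where ij: "Min (range (($) d)) = d $ i" "Max (range (($) d)) = d $ j"
    by blast
  have "(d $ j - d $ i)\<^sup>2 \<le> 2 * (norm d)\<^sup>2"
  proof (cases "i = j")
    case False
    have "0 \<le> (d $ j + d $ i)\<^sup>2" by simp
    then have "(d $ j - d $ i)\<^sup>2 \<le> 2 * ((d $ i)\<^sup>2 + (d $ j)\<^sup>2)"
      by (simp add: power2_sum power2_diff)
    also have "(d $ i)\<^sup>2 + (d $ j)\<^sup>2 = (\<Sum>k\<in>{i, j}. (d $ k)\<^sup>2)"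
      using False by simp
    also have "\<dots> \<le> (\<Sum>k\<in>UNIV. (d $ k)\<^sup>2)"
      by (intro sum_mono2) auto
    also have "\<dots> = (norm d)\<^sup>2"
      unfolding power2_norm_eq_inner inner_vec_def by (simp add: power2_eq_square)
    finally show ?thesis by simp
  qed auto
  moreover have "d $ i \<le> d $ k \<and> d $ k \<le> d $ j" for k
    by (simp flip: ij)
  ultimately show thesis by (rule that[rotated])
qed

text \<open>Here \<open>q l i\<close> is the probability of \<open>i\<close> within nest \<open>l\<close> and \<open>Q l\<close>
  that of nest \<open>l\<close>; the gradient is minus the vector of choice probabilities.\<close>

lemma nested_logit_quadratic_bounds:
  fixes a :: "real^'n"
  assumes "L \<noteq> 0"
    and ne: "\<And>l. l \<in> {1..L} \<Longrightarrow> N l \<noteq> {}"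
    and \<mu>: "\<And>l. l \<in> {1..L} \<Longrightarrow> 0 < \<mu> l \<and> \<mu> l \<le> 1"
  shows "\<exists>g. quadratic_bounds (nested_logit_surplus a L N \<mu>) g (1 / (MIN l\<in>{1..L}. \<mu> l))"
proof -
  define \<beta> where "\<beta> = (MIN l\<in>{1..L}. \<mu> l)"
  have \<beta>_le: "\<beta> \<le> \<mu> l" if "l \<in> {1..L}" for l
    unfolding \<beta>_def using that by (intro Min_le) auto
  have "\<beta> \<in> \<mu> ` {1..L}"
    unfolding \<beta>_def using assms(1) by (intro Min_in) auto
  then have \<beta>: "0 < \<beta>" "\<beta> \<le> 1" using \<mu> by auto
  define e where "e = (\<lambda>p l i. exp ((a $ i - p $ i) / \<mu> l))"
  define S where "S = (\<lambda>p l. \<Sum>i\<in>N l. e p l i)"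
  define Z where "Z = (\<lambda>p. \<Sum>l\<in>{1..L}. S p l powr \<mu> l)"
  define q where "q = (\<lambda>p l i. e p l i / S p l)"
  define Q where "Q = (\<lambda>p l. S p l powr \<mu> l / Z p)"
  define g where "g = (\<lambda>p. \<chi> i. - (\<Sum>l\<in>{1..L}. if i \<in> N l then Q p l * q p l i else 0))"
  have E: "nested_logit_surplus a L N \<mu> p = ln (Z p)" for p
    by (simp add: nested_logit_surplus_def Z_def S_def e_def)
  have S: "0 < S p l" if "l \<in> {1..L}" for p l
    unfolding S_def e_def using ne[OF that] by (intro sum_pos) auto
  have Z: "0 < Z p" for p
    unfolding Z_def using assms(1) S by (intro sum_pos) (auto simp: less_imp_neq[symmetric])
  have q: "0 \<le> q p l i" "(\<Sum>i\<in>N l. q p l i) = 1" if "l \<in> {1..L}" for p l i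
    using S[OF that, of p] by (auto simp: q_def e_def S_def simp flip: sum_divide_distrib)
  have Q: "0 \<le> Q p l" "(\<Sum>l\<in>{1..L}. Q p l) = 1" for p l
    using Z[of p] by (auto simp: Q_def Z_def simp flip: sum_divide_distrib)
  have "quadratic_bounds (nested_logit_surplus a L N \<mu>) g (1 / \<beta>)"
    unfolding quadratic_bounds_def E
  proof (intro allI)
    fix p d :: "real^'n"
    obtain lo hi where range: "\<And>i. lo \<le> (- d) $ i \<and> (- d) $ i \<le> hi"
        "(hi - lo)\<^sup>2 \<le> 2 * (norm (- d))\<^sup>2"
      using range_square_le[of "- d"] by metis
    \<comment> \<open>Within nest \<open>l\<close>, \<open>m l\<close> is the mean of
      \<open>- d\<close> and \<open>x l\<close> its log-moment generating function at
      \<open>1 / \<mu> l\<close>, rescaled by \<open>\<mu> l\<close>; the outer stage averages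
      \<open>exp (x l)\<close> with weights \<open>Q p l\<close>.\<close>
    define m where "m = (\<lambda>l. \<Sum>i\<in>N l. q p l i * (- d $ i))"
    define W where "W = (\<lambda>l. \<Sum>i\<in>N l. q p l i * exp (- d $ i / \<mu> l))"
    define x where "x = (\<lambda>l. \<mu> l * ln (W l))"
    have gd: "g p \<bullet> d = (\<Sum>l\<in>{1..L}. Q p l * m l)"
    proof -
      have "g p \<bullet> d = (\<Sum>i\<in>UNIV. \<Sum>l\<in>{1..L}. if i \<in> N l then Q p l * (q p l i * (- d $ i)) else 0)"
        unfolding inner_vec_def g_def
        by (auto simp: sum_distrib_right simp flip: sum_negf intro!: sum.cong)
      also have "\<dots> = (\<Sum>l\<in>{1..L}. \<Sum>i\<in>UNIV. if i \<in> N l then Q p l * (q p l i * (- d $ i)) else 0)"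
        by (rule sum.swap)
      also have "\<dots> = (\<Sum>l\<in>{1..L}. Q p l * m l)"
        unfolding m_def sum_distrib_left by (simp add: sum.If_cases)
      finally show ?thesis .
    qed
    \<comment> \<open>Dividing by \<open>\<mu> l\<close> scales Hoeffding's error by
      \<open>1 / (\<mu> l)\<^sup>2\<close>, and the outer factor \<open>\<mu> l\<close> restores one
      power. Since \<open>x l\<close> stays in \<open>[lo, hi]\<close>, the outer stage has the same
      range.\<close>
    have inner: "0 < W l \<and> m l \<le> x l \<and> x l \<le> m l + (hi - lo)\<^sup>2 / (8 * \<beta>) \<and> lo \<le> x l \<and> x l \<le> hi"
      if l: "l \<in> {1..L}" for l
    proof -
      have pos: "0 < \<mu> l" using \<mu>[OF l] by simp
      have r: "lo / \<mu> l \<le> - d $ i / \<mu> l \<and> - d $ i / \<mu> l \<le> hi / \<mu> l" for i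
        using range(1)[of i] pos by (simp add: divide_right_mono del: divide_minus_left)
      have fin: "finite (N l)" by simp
      have W: "W l = (\<Sum>i\<in>N l. q p l i * exp (- d $ i / \<mu> l))"
        by (simp add: W_def)
      note b = ln_sum_exp_bounds[where I = "N l" and w = "q p l" and x = "\<lambda>i. - d $ i / \<mu> l"
          and l = "lo / \<mu> l" and u = "hi / \<mu> l", OF fin q[OF l] r, folded W]
      have mean: "\<mu> l * (\<Sum>i\<in>N l. q p l i * (- d $ i / \<mu> l)) = m l"
        unfolding m_def sum_distrib_left using pos by (intro sum.cong) auto
      have "m l \<le> x l"
        using mult_left_mono[OF b(2), of "\<mu> l"] pos unfolding mean x_def by simp
      moreover have "x l \<le> m l + (hi - lo)\<^sup>2 / (8 * \<beta>)"
      proof -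
        have "x l \<le> m l + \<mu> l * ((hi / \<mu> l - lo / \<mu> l)\<^sup>2 / 8)"
          using mult_left_mono[OF b(3), of "\<mu> l"] pos unfolding distrib_left mean x_def by simp
        also have "\<mu> l * ((hi / \<mu> l - lo / \<mu> l)\<^sup>2 / 8) = (hi - lo)\<^sup>2 / (8 * \<mu> l)"
          using pos by (simp add: power_divide power2_eq_square flip: diff_divide_distrib)
        also have "\<dots> \<le> (hi - lo)\<^sup>2 / (8 * \<beta>)"
          using \<beta>(1) \<beta>_le[OF l] by (intro divide_left_mono) auto
        finally show ?thesis by simp
      qed
      moreover have "lo \<le> x l" "x l \<le> hi"
        using b(4,5) pos unfolding x_def by (simp_all add: field_simps)
      ultimately show ?thesis using b(1) by blast
    qed
    have S_shift: "S (p + d) l = S p l * W l" if l: "l \<in> {1..L}" for l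
    proof -
      have "e (p + d) l i = e p l i * exp (- d $ i / \<mu> l)" for i
        by (simp add: e_def diff_divide_distrib add_divide_distrib flip: exp_add)
      then have "S (p + d) l = (\<Sum>i\<in>N l. e p l i * exp (- d $ i / \<mu> l))"
        by (simp add: S_def)
      also have "\<dots> = S p l * W l"
        using S[OF l, of p] by (simp add: W_def q_def sum_distrib_left)
      finally show ?thesis .
    qed
    \<comment> \<open>Because \<open>W l powr \<mu> l = exp (x l)\<close>, the ratio
      \<open>Z (p + d) / Z p\<close> is the mean of \<open>exp (x l)\<close> under
      \<open>Q p\<close>.\<close>
    have "S (p + d) l powr \<mu> l = Z p * (Q p l * exp (x l))" if l: "l \<in> {1..L}" for l
      using inner[OF l] S[OF l, of p] Z[of p]
      by (simp add: S_shift[OF l] powr_mult Q_def x_def powr_def[of "W l"])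
    then have "(\<Sum>l\<in>{1..L}. S (p + d) l powr \<mu> l) = Z p * (\<Sum>l\<in>{1..L}. Q p l * exp (x l))"
      by (simp add: sum_distrib_left)
    then have "Z (p + d) = Z p * (\<Sum>l\<in>{1..L}. Q p l * exp (x l))"
      by (simp add: Z_def)
    moreover note b = ln_sum_exp_bounds[where I = "{1..L}" and w = "Q p" and x = x and l = lo and u = hi,
        OF finite_atLeastAtMost Q]
    ultimately have lnZ: "ln (Z (p + d)) = ln (Z p) + ln (\<Sum>l\<in>{1..L}. Q p l * exp (x l))"
      using inner Z[of p] by (simp add: ln_mult)
    have "(\<Sum>l\<in>{1..L}. Q p l * m l) \<le> (\<Sum>l\<in>{1..L}. Q p l * x l)"
      using inner Q by (intro sum_mono mult_left_mono) auto
    also have "\<dots> \<le> ln (\<Sum>l\<in>{1..L}. Q p l * exp (x l))"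
      using inner by (intro b(2)) auto
    finally have lower: "ln (Z p) + g p \<bullet> d \<le> ln (Z (p + d))"
      unfolding lnZ gd by simp
    have "ln (\<Sum>l\<in>{1..L}. Q p l * exp (x l)) \<le> (\<Sum>l\<in>{1..L}. Q p l * x l) + (hi - lo)\<^sup>2 / 8"
      using inner by (intro b(3)) auto
    also have "(\<Sum>l\<in>{1..L}. Q p l * x l) \<le> (\<Sum>l\<in>{1..L}. Q p l * (m l + (hi - lo)\<^sup>2 / (8 * \<beta>)))"
      using inner Q by (intro sum_mono mult_left_mono) auto
    also have "\<dots> = g p \<bullet> d + (hi - lo)\<^sup>2 / (8 * \<beta>)"
      by (simp only: gd distrib_left sum.distrib sum_distrib_right[symmetric] Q(2) mult_1_left)
    \<comment> \<open>Here \<open>\<beta> \<le> 1\<close> absorbs the error between nests into a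
      second copy of the error within them.\<close>
    also have "g p \<bullet> d + (hi - lo)\<^sup>2 / (8 * \<beta>) + (hi - lo)\<^sup>2 / 8
        \<le> g p \<bullet> d + (hi - lo)\<^sup>2 / (4 * \<beta>)"
      using \<beta> mult_right_mono[OF \<beta>(2), of "(hi - lo)\<^sup>2"] by (simp add: field_simps)
    also have "\<dots> \<le> g p \<bullet> d + 2 * (norm d)\<^sup>2 / (4 * \<beta>)"
      using range(2) \<beta>(1) by (intro add_left_mono divide_right_mono) auto
    finally have "ln (Z (p + d)) \<le> ln (Z p) + g p \<bullet> d + 1 / \<beta> / 2 * (norm d)\<^sup>2"
      unfolding lnZ using \<beta>(1) by (simp add: field_simps)
    with lower show "ln (Z p) + g p \<bullet> d \<le> ln (Z (p + d)) \<and>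
        ln (Z (p + d)) \<le> ln (Z p) + g p \<bullet> d + 1 / \<beta> / 2 * (norm d)\<^sup>2"
      by simp
  qed
  then show ?thesis unfolding \<beta>_def by blast
qed

section \<open>Smoothness of the total expected revenue\<close>

theorem theorem3p7:
  fixes J K :: nat
    and \<N> :: "nat \<Rightarrow> real"
    and a :: "nat \<Rightarrow> real^'n"
    and L :: "nat \<Rightarrow> nat"
    and N :: "nat \<Rightarrow> nat \<Rightarrow> 'n set"
    and \<mu> :: "nat \<Rightarrow> nat \<Rightarrow> real"
    and Y :: "nat \<Rightarrow> (real^'n) set"
    and chat :: "nat \<Rightarrow> real^'n \<Rightarrow> real"
    and \<Gamma> :: "nat \<Rightarrow> real"
    and yhat :: "nat \<Rightarrow> real^'n"
  assumes "\<And>j. j \<in> {1..J} \<Longrightarrow> 0 < \<N> j"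
    and "\<And>j l. j \<in> {1..J} \<Longrightarrow> l \<in> {1..L j} \<Longrightarrow> N j l \<noteq> {}"
    and "\<And>j. j \<in> {1..J} \<Longrightarrow> disjoint_family_on (N j) {1..L j}"
    and "\<And>j. j \<in> {1..J} \<Longrightarrow> (\<Union>l\<in>{1..L j}. N j l) = UNIV"
    and "\<And>j l. j \<in> {1..J} \<Longrightarrow> l \<in> {1..L j} \<Longrightarrow> 0 < \<mu> j l \<and> \<mu> j l \<le> 1"
    and "\<And>k. k \<in> {1..K} \<Longrightarrow> Y k \<noteq> {} \<and> closed (Y k) \<and> convex (Y k)"
    and "\<And>k. k \<in> {1..K} \<Longrightarrow> convex_on UNIV (chat k)"
    and "\<And>k. k \<in> {1..K} \<Longrightarrow> 0 < \<Gamma> k"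
  shows "strongly_smooth_on price_vectors
           ((\<Sum>j\<in>{1..J}. \<N> j / (MIN l\<in>{1..L j}. \<mu> j l)) + (\<Sum>k\<in>{1..K}. 1 / \<Gamma> k))
           (TER K (\<lambda>k. profit (Y k) (cost (chat k) (\<Gamma> k) (yhat k)))
                J \<N> (\<lambda>j. nested_logit_surplus (a j) (L j) (N j) (\<mu> j)))"
proof -
  \<comment> \<open>The nests cover the nonempty set of products, so there is at least one;
    otherwise the \<open>MIN\<close> would range over the empty set.\<close>
  have L: "L j \<noteq> 0" if "j \<in> {1..J}" for j
    using assms(4)[OF that] by (cases "L j") auto
  have "\<forall>j\<in>{1..J}. \<exists>g. quadratic_bounds (nested_logit_surplus (a j) (L j) (N j) (\<mu> j)) g
      (1 / (MIN l\<in>{1..L j}. \<mu> j l))"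
    by (intro ballI nested_logit_quadratic_bounds L assms(2,5))
  then obtain gE where gE: "\<And>j. j \<in> {1..J} \<Longrightarrow>
      quadratic_bounds (nested_logit_surplus (a j) (L j) (N j) (\<mu> j)) (gE j)
        (1 / (MIN l\<in>{1..L j}. \<mu> j l))"
    by metis
  have "\<forall>k\<in>{1..K}. \<exists>g. quadratic_bounds (profit (Y k) (cost (chat k) (\<Gamma> k) (yhat k))) g (1 / \<Gamma> k)"
    using assms(6-8) by (blast intro: profit_quadratic_bounds)
  then obtain g\<pi> where g\<pi>: "\<And>k. k \<in> {1..K} \<Longrightarrow>
      quadratic_bounds (profit (Y k) (cost (chat k) (\<Gamma> k) (yhat k))) (g\<pi> k) (1 / \<Gamma> k)"
    by metis
  let ?TER = "TER K (\<lambda>k. profit (Y k) (cost (chat k) (\<Gamma> k) (yhat k)))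
      J \<N> (\<lambda>j. nested_logit_surplus (a j) (L j) (N j) (\<mu> j))"
  have "quadratic_bounds ?TER
      (\<lambda>p. (\<Sum>k\<in>{1..K}. g\<pi> k p) + (\<Sum>j\<in>{1..J}. \<N> j *\<^sub>R gE j p))
      ((\<Sum>k\<in>{1..K}. 1 / \<Gamma> k) + (\<Sum>j\<in>{1..J}. \<N> j * (1 / (MIN l\<in>{1..L j}. \<mu> j l))))"
    unfolding TER_def[abs_def]
    by (intro quadratic_bounds_add quadratic_bounds_sum quadratic_bounds_cmult finite_atLeastAtMost
        gE g\<pi> less_imp_le[OF assms(1)])
  then have bounds: "quadratic_bounds ?TER
      (\<lambda>p. (\<Sum>k\<in>{1..K}. g\<pi> k p) + (\<Sum>j\<in>{1..J}. \<N> j *\<^sub>R gE j p))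
      ((\<Sum>j\<in>{1..J}. \<N> j / (MIN l\<in>{1..L j}. \<mu> j l)) + (\<Sum>k\<in>{1..K}. 1 / \<Gamma> k))"
    by (simp add: add.commute)
  \<comment> \<open>Passing from quadratic bounds to a Lipschitz gradient requires a nonnegative
    modulus.\<close>
  have "0 \<le> (MIN l\<in>{1..L j}. \<mu> j l)" if "j \<in> {1..J}" for j
    using L[OF that] assms(5)[OF that] by (subst Min_ge_iff) (auto simp: less_imp_le)
  then have "0 \<le> (\<Sum>j\<in>{1..J}. \<N> j / (MIN l\<in>{1..L j}. \<mu> j l)) + (\<Sum>k\<in>{1..K}. 1 / \<Gamma> k)"
    using assms(1,8) by (intro add_nonneg_nonneg sum_nonneg divide_nonneg_nonneg)
      (auto simp: less_imp_le)
  with bounds show ?thesis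
    by (rule quadratic_bounds_strongly_smooth)
qed

end
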